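(* For every positive integer $k$, $$\sum_{i=1}^k(-1)^i\,i!\,(\ln2)^{k-i}\binom ki\left\{\zeta\left(2,\{1\}_{i-1}\right)-\zeta\left(2,\{1\}_{i-1};\tfrac12\right)\right\}=(-1)^k\,k!\,\mathrm{Li}_{k+1}\left(\tfrac12\right)-(\ln2)^{k+1}.$$
   Context: Notation. $\{1\}_r$ denotes the string of $r$ entries equal to $1$ (empty if $r=0$). For positive integers $s_1,\dots,s_r$ with $s_1\ge2$, $\zeta(s_1,\dots,s_r):=\sum_{k_1>\cdots>k_r\ge1}\frac{1}{k_1^{s_1}\cdots k_r^{s_r}}$; for $x\in[-1,1)$, $\zeta(s_1,\dots,s_r;x):=\sum_{k_1>\cdots>k_r\ge1}\frac{x^{k_1}}{k_1^{s_1}\cdots k_r^{s_r}}$; and $\mathrm{Li}_p(x):=\sum_{n\ge1}x^n/n^p$. *)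

theory Defs
  imports "HOL-Analysis.Analysis"
begin

text \<open>The index set of a multiple sum truncated at \<open>N\<close>: tuples
  \<open>N \<ge> k\<^sub>1 > \<dots> > k\<^sub>r \<ge> 1\<close>, as lists with \<open>k\<^sub>1\<close> at the head.\<close>

definition decr_tuples :: "nat \<Rightarrow> nat \<Rightarrow> nat list set" where
  "decr_tuples r N = {ks. length ks = r \<and> sorted_wrt (>) ks \<and> set ks \<subseteq> {1..N}}"

text \<open>Multiple sums are limits of their truncations at \<open>k\<^sub>1 \<le> N\<close> rather than unordered sums,
  since convergence is only conditional at \<open>x = -1\<close>, \<open>s\<^sub>1 = 1\<close>. The exponents \<open>s\<^sub>1, \<dots>, s\<^sub>r\<close> are
  meant to be positive, with \<open>s\<^sub>1 \<ge> 2\<close> in the first definition and \<open>r \<ge> 1\<close>,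
  \<open>x \<in> [-1, 1)\<close> in the second; otherwise the values carry no meaning.\<close>

definition mzeta :: "nat list \<Rightarrow> real" where
  "mzeta ss = lim (\<lambda>N. \<Sum>ks\<in>decr_tuples (length ss) N.
     1 / (\<Prod>j<length ss. real (ks ! j) ^ (ss ! j)))"

definition mzeta_at :: "nat list \<Rightarrow> real \<Rightarrow> real" where
  "mzeta_at ss x = lim (\<lambda>N. \<Sum>ks\<in>decr_tuples (length ss) N.
     x ^ hd ks / (\<Prod>j<length ss. real (ks ! j) ^ (ss ! j)))"

definition polylog :: "nat \<Rightarrow> real \<Rightarrow> real" where
  "polylog p x = (\<Sum>n. x ^ Suc n / real (Suc n) ^ p)"

end

theory Submission
  imports Defs "HOL-Real_Asymp.Real_Asymp"
begin

text \<open>Write \<open>A\<^sub>i(x) = \<zeta>(2, {1}\<^bsub>i-1\<^esub>; x)\<close>. Then \<open>A\<^sub>i'(x) = (-ln (1 - x)) ^ i / (i! x)\<close>, so by the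
  binomial theorem \<open>(\<Sum>i=1..k. (-1) ^ i i! (ln 2) ^ (k-i) (k choose i) A\<^sub>i(x)) + (ln 2) ^ k ln x\<close> has
  derivative \<open>ln (2 (1 - x)) ^ k / x\<close>. With \<open>u = 1 - x\<close>, integrating \<open>ln (2u) ^ k / (1 - u)\<close> repeatedly
  by parts gives another antiderivative, built from \<open>ln (2u) ^ (k-j) Li\<^bsub>j+1\<^esub>(u)\<close>. At \<open>x = 1/2\<close> only
  the \<open>Li\<^bsub>k+1\<^esub>\<close> term survives and as \<open>x \<longrightarrow> 1\<close> all of them vanish, so comparing the two
  antiderivatives at these points yields the identity.\<close>

section \<open>Truncated multiple sums as iterated sums\<close>

lemma decr_tuples_0: "decr_tuples 0 N = {[]}"
  by (auto simp: decr_tuples_def)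

lemma decr_tuples_Suc_0: "decr_tuples (Suc r) 0 = {}"
  by (auto simp: decr_tuples_def)

lemma decr_tuples_Suc_Suc:
  "decr_tuples (Suc r) (Suc N) = decr_tuples (Suc r) N \<union> (#) (Suc N) ` decr_tuples r N"
proof (intro set_eqI iffI)
  fix ks assume A: "ks \<in> decr_tuples (Suc r) (Suc N)"
  then obtain a as where ks: "ks = a # as"
    by (cases ks) (auto simp: decr_tuples_def)
  show "ks \<in> decr_tuples (Suc r) N \<union> (#) (Suc N) ` decr_tuples r N"
  proof (cases "a = Suc N")
    case True
    then show ?thesis using A ks by (force simp: decr_tuples_def)
  next
    case False
    then show ?thesis using A ks by (force simp: decr_tuples_def)
  qed
next
  fix ks assume "ks \<in> decr_tuples (Suc r) N \<union> (#) (Suc N) ` decr_tuples r N"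
  then show "ks \<in> decr_tuples (Suc r) (Suc N)"
    by (force simp: decr_tuples_def)
qed

lemma finite_decr_tuples: "finite (decr_tuples r N)"
proof (rule finite_subset)
  show "decr_tuples r N \<subseteq> {ks. set ks \<subseteq> {1..N} \<and> length ks = r}"
    by (auto simp: decr_tuples_def)
qed (rule finite_lists_length_eq, simp)

text \<open>Tuples are grouped by their head \<open>Suc m\<close>; the remaining entries then form
  an arbitrary decreasing tuple bounded by \<open>m\<close>. This peels off the outermost summation
  index.\<close>

lemma sum_decr_tuples_Suc:
  fixes f :: "nat list \<Rightarrow> real"
  shows "sum f (decr_tuples (Suc r) N) = (\<Sum>m<N. \<Sum>ks\<in>decr_tuples r m. f (Suc m # ks))"
proof (induction N)
  case 0
  then show ?case by (simp add: decr_tuples_Suc_0)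
next
  case (Suc N)
  have "decr_tuples (Suc r) N \<inter> (#) (Suc N) ` decr_tuples r N = {}"
    by (auto simp: decr_tuples_def)
  then have "sum f (decr_tuples (Suc r) (Suc N)) =
      sum f (decr_tuples (Suc r) N) + sum f ((#) (Suc N) ` decr_tuples r N)"
    unfolding decr_tuples_Suc_Suc by (intro sum.union_disjoint finite_imageI finite_decr_tuples)
  then show ?case by (simp add: Suc.IH sum.reindex)
qed

text \<open>Multiple harmonic sums with all exponents 1, that is, the elementary symmetric
  polynomials in 1, 1/2, ..., 1/n, by recursion on the largest index \<open>Suc m\<close>.\<close>

primrec harm_nested :: "nat \<Rightarrow> nat \<Rightarrow> real" where
  "harm_nested 0 n = 1"
| "harm_nested (Suc r) n = (\<Sum>m<n. harm_nested r m / real (Suc m))"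

lemma sum_decr_tuples_ones:
  "(\<Sum>ks\<in>decr_tuples r N. 1 / (\<Prod>j<r. real (ks ! j))) = harm_nested r N"
proof (induction r arbitrary: N)
  case 0
  then show ?case by (simp add: decr_tuples_0)
next
  case (Suc r)
  have "(\<Sum>ks\<in>decr_tuples r m. 1 / (\<Prod>j<Suc r. real ((Suc m # ks) ! j))) =
      harm_nested r m / real (Suc m)" for m
    by (simp add: prod.lessThan_Suc_shift flip: Suc.IH sum_divide_distrib del: prod.lessThan_Suc)
       (simp add: sum_divide_distrib mult.commute)
  then show ?case by (simp add: sum_decr_tuples_Suc del: prod.lessThan_Suc)
qed

text \<open>Only the largest index carries the square and the power of \<open>x\<close>; summing out
  the others leaves a single power series with coefficients \<open>harm_nested r m\<close>.\<close>

lemma mzeta_at_summand_sum: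
  "(\<Sum>ks\<in>decr_tuples (length (2 # replicate r 1)) N.
      x ^ hd ks / (\<Prod>j<length (2 # replicate r 1). real (ks ! j) ^ ((2 # replicate r 1) ! j)))
    = (\<Sum>m<N. harm_nested r m * x ^ Suc m / real (Suc m) ^ 2)"
proof -
  have "(\<Sum>ks\<in>decr_tuples r m. x ^ hd (Suc m # ks) /
        (\<Prod>j<Suc r. real ((Suc m # ks) ! j) ^ ((2 # replicate r 1) ! j))) =
      harm_nested r m * x ^ Suc m / real (Suc m) ^ 2" (is "sum ?f _ = _") for m
  proof -
    have "?f ks = (1 / (\<Prod>j<r. real (ks ! j))) * (x ^ Suc m / real (Suc m) ^ 2)" for ks
      unfolding prod.lessThan_Suc_shift by simp
    then have "sum ?f (decr_tuples r m) =
        (\<Sum>ks\<in>decr_tuples r m. 1 / (\<Prod>j<r. real (ks ! j))) * (x ^ Suc m / real (Suc m) ^ 2)"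
      unfolding sum_distrib_right by (intro sum.cong refl)
    then show ?thesis unfolding sum_decr_tuples_ones by simp
  qed
  then show ?thesis unfolding length_Cons length_replicate sum_decr_tuples_Suc
    by (intro sum.cong) auto
qed

section \<open>Growth of the nested harmonic sums\<close>

lemma harm_nested_nonneg: "0 \<le> harm_nested r n"
  by (induction r arbitrary: n) (auto intro!: sum_nonneg divide_nonneg_nonneg)

text \<open>The generating function \<open>\<Sum>r. harm_nested r n * t ^ r\<close> is \<open>\<Prod>m=1..n. (1 + t / m)\<close>,
  which is at most \<open>sqrt (n + 1)\<close> at \<open>t = 1/3\<close>.\<close>
lemma harm_nested_le: "harm_nested r n \<le> 3 ^ r * sqrt (real (Suc n))"
proof (induction n arbitrary: r)
  case 0
  then show ?case by (cases r) auto
next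
  case (Suc n)
  show ?case
  proof (cases r)
    case 0
    then show ?thesis by simp
  next
    case (Suc q)
    define y where "y = real (Suc n)"
    have y: "y \<ge> 1" by (simp add: y_def)
    have "harm_nested r (Suc n) = harm_nested (Suc q) n + harm_nested q n / y"
      by (simp add: Suc y_def)
    also have "\<dots> \<le> 3 ^ Suc q * sqrt y + 3 ^ q * sqrt y / y"
      using Suc.IH[of "Suc q"] Suc.IH[of q] y
      by (intro add_mono divide_right_mono) (auto simp: y_def)
    also have "\<dots> = 3 ^ r * (sqrt y * (1 + 1 / (3 * y)))"
      using y by (simp add: Suc field_simps)
    \<comment> \<open>The choice t = 1/3 leaves room in the square: 2/3 + 1/(9y) is below 1 for y at
      least 1. With t = 1/2 one would get 1 + 1/(4y), just too much.\<close>
    also have "sqrt y * (1 + 1 / (3 * y)) \<le> sqrt (y + 1)"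
    proof (rule real_le_rsqrt)
      have "(sqrt y * (1 + 1 / (3 * y)))\<^sup>2 = y + 2 / 3 + 1 / (9 * y)"
        using y by (simp add: power_mult_distrib power2_eq_square field_simps)
      also have "1 / (9 * y) \<le> 1 / 9" using y by (simp add: field_simps)
      finally show "(sqrt y * (1 + 1 / (3 * y)))\<^sup>2 \<le> y + 1" by simp
    qed
    finally show ?thesis by (simp add: y_def algebra_simps)
  qed
qed

section \<open>Power series with linearly growing coefficients\<close>

text \<open>Shifted by one factor \<open>x\<close> from a polylogarithm, so that \<open>x * dpow c p x\<close> has derivative
  \<open>dpow c (p - 1) x\<close> without a division by \<open>x\<close>.\<close>
definition dpow :: "(nat \<Rightarrow> real) \<Rightarrow> nat \<Rightarrow> real \<Rightarrow> real" where
  "dpow c p x = (\<Sum>m. c m * x ^ m / real (Suc m) ^ p)"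

text \<open>A common hypothesis for the two coefficient sequences in use, the constant 1 and
  \<open>harm_nested r\<close>; it makes the radius of convergence at least 1 for every
  \<open>p\<close>.\<close>

locale linear_growth =
  fixes c :: "nat \<Rightarrow> real" and C :: real
  assumes growth: "\<bar>c m\<bar> \<le> C * real (Suc m)"
begin

lemma summable_dpow:
  assumes "\<bar>x\<bar> < 1"
  shows "summable (\<lambda>m. c m * x ^ m / real (Suc m) ^ p)"
proof (rule summable_comparison_test)
  show "\<exists>N. \<forall>m\<ge>N. norm (c m * x ^ m / real (Suc m) ^ p) \<le> C * (real (Suc m) * \<bar>x\<bar> ^ m)"
  proof (intro exI allI impI)
    fix m
    have "norm (c m * x ^ m / real (Suc m) ^ p) = \<bar>c m\<bar> * \<bar>x\<bar> ^ m / real (Suc m) ^ p"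
      by (simp add: abs_mult power_abs)
    also have "\<dots> \<le> \<bar>c m\<bar> * \<bar>x\<bar> ^ m / 1"
      by (intro divide_left_mono) (auto intro!: one_le_power mult_nonneg_nonneg)
    also have "\<dots> \<le> C * real (Suc m) * \<bar>x\<bar> ^ m"
      using growth[of m] by (simp add: mult_right_mono)
    finally show "norm (c m * x ^ m / real (Suc m) ^ p) \<le> C * (real (Suc m) * \<bar>x\<bar> ^ m)"
      by (simp add: mult.assoc)
  qed
  \<comment> \<open>The majorant is the termwise derivative of the geometric series.\<close>
  have "summable (\<lambda>m. diffs (\<lambda>_. 1) m * \<bar>x\<bar> ^ m)"
    by (rule termdiff_converges[of _ 1]) (use assms in \<open>auto intro!: summable_geometric\<close>)
  then show "summable (\<lambda>m. C * (real (Suc m) * \<bar>x\<bar> ^ m))"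
    by (intro summable_mult) (simp add: diffs_def)
qed

lemma DERIV_dpow:
  assumes "\<bar>x\<bar> < 1"
  shows "((\<lambda>x. x * dpow c (Suc p) x) has_real_derivative dpow c p x) (at x)"
proof -
  \<comment> \<open>Coefficients of \<open>x * dpow c (Suc p) x\<close> as an ordinary power series:
    the shift by one makes termwise differentiation cancel exactly one factor of the
    denominator.\<close>
  define a where "a = (\<lambda>n. if n = 0 then 0 else c (n - 1) / real n ^ Suc p)"
  have a_Suc: "a (Suc n) * y ^ Suc n = y * (c n * y ^ n / real (Suc n) ^ Suc p)" for n y
    by (simp add: a_def)
  have sm: "summable (\<lambda>n. a n * y ^ n)" if "\<bar>y\<bar> < 1" for y
    using summable_mult[OF summable_dpow[OF that, of "Suc p"], of y]
    by (subst summable_Suc_iff[symmetric]) (simp only: a_Suc)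
  have eq: "(\<Sum>n. a n * y ^ n) = y * dpow c (Suc p) y" if "\<bar>y\<bar> < 1" for y
  proof -
    have "(\<Sum>n. a n * y ^ n) = (\<Sum>n. a (Suc n) * y ^ Suc n)"
      using suminf_split_head[OF sm[OF that]] by (simp add: a_def)
    also have "\<dots> = y * dpow c (Suc p) y"
      unfolding a_Suc dpow_def by (intro suminf_mult summable_dpow that)
    finally show ?thesis .
  qed
  have "DERIV (\<lambda>x. \<Sum>n. a n * x ^ n) x :> (\<Sum>n. diffs a n * x ^ n)"
    by (rule termdiffs_strong'[of 1]) (use assms sm in auto)
  also have "(\<Sum>n. diffs a n * x ^ n) = dpow c p x"
    unfolding dpow_def by (intro suminf_cong) (simp add: diffs_def a_def del: of_nat_Suc)
  finally show ?thesis
  proof (rule DERIV_cong_ev[THEN iffD1, rotated 3])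
    show "\<forall>\<^sub>F y in nhds x. (\<Sum>n. a n * y ^ n) = y * dpow c (Suc p) y"
    proof (rule eventually_nhds_in_open[THEN eventually_mono])
      show "open {-1<..<1::real}" "x \<in> {-1<..<1}" using assms by auto
    qed (auto intro!: eq)
  qed auto
qed

lemma isCont_dpow:
  assumes "\<bar>x\<bar> < 1"
  shows "isCont (dpow c p) x"
proof -
  have "isCont (\<lambda>x. \<Sum>n. (c n / real (Suc n) ^ p) * x ^ n) x"
    by (rule isCont_powser'[of _ _ "\<lambda>n. c n / real (Suc n) ^ p" "(1 + \<bar>x\<bar>) / 2"])
       (use assms summable_dpow[of "(1 + \<bar>x\<bar>) / 2" p] in auto)
  then show ?thesis by (simp add: dpow_def[abs_def])
qed

end

interpretation one: linear_growth "\<lambda>_. 1" 1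
  by unfold_locales auto

interpretation harm: linear_growth "harm_nested r" "3 ^ r" for r
proof
  fix m
  have "sqrt (real (Suc m)) \<le> real (Suc m)"
    by (rule real_le_lsqrt) (auto simp: power2_eq_square)
  then have "3 ^ r * sqrt (real (Suc m)) \<le> 3 ^ r * real (Suc m)"
    by (intro mult_left_mono) auto
  with harm_nested_le[of r m] show "\<bar>harm_nested r m\<bar> \<le> 3 ^ r * real (Suc m)"
    using harm_nested_nonneg[of r m] by linarith
qed

section \<open>Closed forms in powers of the logarithm\<close>

lemma polylog_eq_dpow:
  assumes "\<bar>x\<bar> < 1"
  shows "polylog p x = x * dpow (\<lambda>_. 1) p x"
  unfolding polylog_def dpow_def
  by (subst suminf_mult[OF one.summable_dpow[OF assms], symmetric]) simp

lemma dpow_one_0: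
  assumes "\<bar>x\<bar> < 1"
  shows "dpow (\<lambda>_. 1) 0 x = 1 / (1 - x)"
  using suminf_geometric[of x] assms by (simp add: dpow_def)

text \<open>Multiplication by 1 - x takes differences of coefficients, and consecutive values of
  \<open>harm_nested (Suc r)\<close> differ by \<open>harm_nested r m / Suc m\<close>.\<close>

lemma dpow_harm_nested_0:
  assumes "\<bar>x\<bar> < 1"
  shows "(1 - x) * dpow (harm_nested (Suc r)) 0 x = x * dpow (harm_nested r) 1 x"
proof -
  let ?h = "harm_nested (Suc r)"
  have sm: "summable (\<lambda>m. ?h m * x ^ m)"
    using harm.summable_dpow[OF assms, of "Suc r" 0] by simp
  have "dpow ?h 0 x = (\<Sum>m. ?h m * x ^ m)" by (simp add: dpow_def)
  also have "\<dots> = (\<Sum>m. ?h (Suc m) * x ^ Suc m)"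
    using suminf_split_head[OF sm] by simp
  also have "\<dots> = (\<Sum>m. x * (?h m * x ^ m) + x * (harm_nested r m * x ^ m / real (Suc m) ^ 1))"
    by (intro suminf_cong) (simp add: algebra_simps)
  also have "\<dots> = (\<Sum>m. x * (?h m * x ^ m)) + (\<Sum>m. x * (harm_nested r m * x ^ m / real (Suc m) ^ 1))"
    by (intro suminf_add[symmetric] summable_mult sm harm.summable_dpow assms)
  also have "(\<Sum>m. x * (?h m * x ^ m)) = x * dpow ?h 0 x"
    by (subst suminf_mult[OF sm]) (simp add: dpow_def)
  also have "(\<Sum>m. x * (harm_nested r m * x ^ m / real (Suc m) ^ 1)) = x * dpow (harm_nested r) 1 x"
    unfolding dpow_def by (rule suminf_mult[OF harm.summable_dpow[OF assms]])
  finally show ?thesis unfolding left_diff_distrib by linarith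
qed

text \<open>Both sides vanish at 0 and have the same derivative: on the left it is the series with
  \<open>p = 0\<close>, which is geometric for \<open>r = 0\<close> and otherwise reduces to the
  previous \<open>r\<close> divided by 1 - x.\<close>

lemma dpow_harm_nested_1:
  assumes "\<bar>x\<bar> < 1"
  shows "x * dpow (harm_nested r) 1 x = (- ln (1 - x)) ^ Suc r / fact (Suc r)"
  using assms
proof (induction r arbitrary: x)
  case 0
  let ?f = "\<lambda>x. x * dpow (harm_nested 0) 1 x - (- ln (1 - x)) ^ 1 / fact 1"
  have "(?f has_real_derivative 0) (at y)" if "\<bar>y\<bar> < 1" for y
  proof -
    have "dpow (harm_nested 0) 0 y = 1 / (1 - y)"
      using dpow_one_0[OF that] by (simp add: harm_nested.simps(1)[abs_def])
    moreover have "((\<lambda>x. (- ln (1 - x)) ^ 1 / fact 1) has_real_derivative 1 / (1 - y)) (at y)"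
      using that by (auto intro!: derivative_eq_intros)
    ultimately show ?thesis
      using DERIV_diff[OF harm.DERIV_dpow[OF that, of 0 0]] by fastforce
  qed
  then have "?f x = ?f 0"
    using 0 by (intro DERIV_isconst3[of "-1" 1 x 0 ?f]) auto
  then show ?case by (simp del: harm_nested.simps)
next
  case (Suc r)
  let ?f = "\<lambda>x. x * dpow (harm_nested (Suc r)) 1 x - (- ln (1 - x)) ^ Suc (Suc r) / fact (Suc (Suc r))"
  have "(?f has_real_derivative 0) (at y)" if y: "\<bar>y\<bar> < 1" for y
  proof -
    have 1: "dpow (harm_nested (Suc r)) 0 y = (- ln (1 - y)) ^ Suc r / fact (Suc r) / (1 - y)"
      using dpow_harm_nested_0[OF y, of r] Suc.IH[OF y] y
      by (simp add: eq_divide_eq mult_ac del: harm_nested.simps fact_Suc power_Suc)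
    have "((\<lambda>x. (- ln (1 - x)) ^ Suc (Suc r) / fact (Suc (Suc r))) has_real_derivative
        (real (Suc (Suc r)) * (- ln (1 - y)) ^ Suc r * (1 / (1 - y))) / fact (Suc (Suc r))) (at y)"
      using y by (auto intro!: derivative_eq_intros simp del: fact_Suc power_Suc of_nat_Suc)
    also have "(real (Suc (Suc r)) * (- ln (1 - y)) ^ Suc r * (1 / (1 - y))) / fact (Suc (Suc r)) =
        (- ln (1 - y)) ^ Suc r / fact (Suc r) / (1 - y)"
      unfolding fact_Suc[of "Suc r"] by (simp del: fact_Suc power_Suc of_nat_Suc)
    finally show ?thesis
      using DERIV_diff[OF harm.DERIV_dpow[OF y, of "Suc r" 0, unfolded 1]] by fastforce
  qed
  then have "?f x = ?f 0"
    using Suc.prems by (intro DERIV_isconst3[of "-1" 1 x 0 ?f]) auto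
  then show ?case by (simp del: harm_nested.simps)
qed

section \<open>Convergence and continuity up to the endpoint 1\<close>

lemma harm_nested_zeta_bound:
  assumes "\<bar>x\<bar> \<le> 1"
  shows "norm (harm_nested r m * x ^ m / real (Suc m) ^ 2) \<le> 3 ^ r * real (Suc m) powr (- 3 / 2)"
proof -
  have "norm (harm_nested r m * x ^ m / real (Suc m) ^ 2) = harm_nested r m * \<bar>x\<bar> ^ m / real (Suc m) ^ 2"
    using harm_nested_nonneg[of r m] by (simp add: abs_mult power_abs)
  \<comment> \<open>The square-root bound is essential: linear growth would leave only a multiple of
    the divergent harmonic series as majorant.\<close>
  also have "\<dots> \<le> (3 ^ r * sqrt (real (Suc m))) * 1 / real (Suc m) ^ 2"
    using assms harm_nested_nonneg[of r m]
    by (intro divide_right_mono mult_mono harm_nested_le power_le_one) auto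
  also have "\<dots> = 3 ^ r * (real (Suc m) powr (1 / 2) / real (Suc m) powr 2)"
    by (simp add: powr_half_sqrt powr_numeral del: of_nat_Suc)
  also have "\<dots> = 3 ^ r * real (Suc m) powr (- 3 / 2)"
    by (subst powr_diff[symmetric]) simp
  finally show ?thesis .
qed

lemma summable_harm_nested_zeta_bound: "summable (\<lambda>m. 3 ^ r * real (Suc m) powr (- 3 / 2))"
proof (rule summable_mult)
  have "summable (\<lambda>m. real m powr (- 3 / 2))"
    by (subst summable_real_powr_iff) simp
  then show "summable (\<lambda>m. real (Suc m) powr (- 3 / 2))"
    by (subst summable_Suc_iff)
qed

lemma summable_harm_nested_zeta:
  assumes "\<bar>x\<bar> \<le> 1"
  shows "summable (\<lambda>m. harm_nested r m * x ^ m / real (Suc m) ^ 2)"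
  by (rule summable_comparison_test[OF _ summable_harm_nested_zeta_bound])
     (use harm_nested_zeta_bound[OF assms] in blast)

lemma mzeta_at_eq_dpow:
  assumes "\<bar>x\<bar> \<le> 1"
  shows "mzeta_at (2 # replicate r 1) x = x * dpow (harm_nested r) 2 x"
proof -
  have "(\<lambda>m. x * (harm_nested r m * x ^ m / real (Suc m) ^ 2)) sums (x * dpow (harm_nested r) 2 x)"
    unfolding dpow_def by (intro sums_mult summable_sums summable_harm_nested_zeta assms)
  then have "(\<lambda>N. \<Sum>m<N. harm_nested r m * x ^ Suc m / real (Suc m) ^ 2) \<longlonglongrightarrow>
      x * dpow (harm_nested r) 2 x"
    by (simp add: sums_def mult_ac)
  then show ?thesis unfolding mzeta_at_def mzeta_at_summand_sum by (rule limI)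
qed

lemma mzeta_eq_mzeta_at: "mzeta ss = mzeta_at ss 1"
  by (simp add: mzeta_def mzeta_at_def)

text \<open>The majorant does not depend on \<open>x\<close>, so convergence is uniform on the
  closed interval. Left continuity at 1 later gives the passage from \<open>mzeta_at\<close> to
  \<open>mzeta\<close>.\<close>

lemma continuous_on_dpow_harm_nested_2: "continuous_on {-1..1} (dpow (harm_nested r) 2)"
proof -
  have "uniform_limit {-1..1} (\<lambda>n x. \<Sum>m<n. harm_nested r m * x ^ m / real (Suc m) ^ 2)
      (\<lambda>x. \<Sum>m. harm_nested r m * x ^ m / real (Suc m) ^ 2) sequentially"
    by (rule Weierstrass_m_test[OF _ summable_harm_nested_zeta_bound])
       (rule harm_nested_zeta_bound, auto)
  then have "continuous_on {-1..1} (\<lambda>x. \<Sum>m. harm_nested r m * x ^ m / real (Suc m) ^ 2)"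
    by (rule uniform_limit_theorem[rotated])
       (simp, intro always_eventually allI continuous_intros, simp_all)
  then show ?thesis by (simp add: dpow_def[abs_def])
qed

lemma DERIV_dpow_harm_nested_2:
  assumes "0 < x" "x < 1"
  shows "((\<lambda>x. x * dpow (harm_nested r) 2 x) has_real_derivative
          (- ln (1 - x)) ^ Suc r / fact (Suc r) / x) (at x)"
proof -
  have "dpow (harm_nested r) 1 x = (- ln (1 - x)) ^ Suc r / fact (Suc r) / x"
    using dpow_harm_nested_1[of x r] assms by (simp add: eq_divide_eq mult_ac del: power_Suc fact_Suc)
  then show ?thesis
    using harm.DERIV_dpow[of x r 1] assms by (simp add: numeral_2_eq_2)
qed

section \<open>The antiderivative from integration by parts\<close>

text \<open>The antiderivative of \<open>ln (2u) ^ k\<close> times the derivative of \<open>Li\<^sub>p\<close>, from repeated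
  integration by parts.\<close>
primrec log_polylog_prim :: "nat \<Rightarrow> nat \<Rightarrow> real \<Rightarrow> real" where
  "log_polylog_prim 0 p u = u * dpow (\<lambda>_. 1) p u"
| "log_polylog_prim (Suc k) p u =
    ln (2 * u) ^ Suc k * (u * dpow (\<lambda>_. 1) p u) - real (Suc k) * log_polylog_prim k (Suc p) u"

text \<open>Differentiating the power of the logarithm gives a factor 1/u that cancels the leading
  \<open>u\<close>; the result is removed by the derivative of the recursive term, whose index is
  one higher.\<close>

lemma DERIV_log_polylog_prim:
  assumes "0 < u" "u < 1"
  shows "(log_polylog_prim k (Suc p) has_real_derivative ln (2 * u) ^ k * dpow (\<lambda>_. 1) p u) (at u)"
proof (induction k arbitrary: p)
  case 0
  have "log_polylog_prim 0 (Suc p) = (\<lambda>u. u * dpow (\<lambda>_. 1) (Suc p) u)" by auto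
  then show ?case using one.DERIV_dpow[of u p] assms by simp
next
  case (Suc k)
  let ?D = "real (Suc k) * ln (2 * u) ^ k * (1 / u)"
  have 1: "((\<lambda>u. ln (2 * u) ^ Suc k) has_real_derivative ?D) (at u)"
    using assms by (auto intro!: derivative_eq_intros simp del: power_Suc of_nat_Suc)
  have "((\<lambda>u. ln (2 * u) ^ Suc k * (u * dpow (\<lambda>_. 1) (Suc p) u)
        - real (Suc k) * log_polylog_prim k (Suc (Suc p)) u) has_real_derivative
      (?D * (u * dpow (\<lambda>_. 1) (Suc p) u) + dpow (\<lambda>_. 1) p u * ln (2 * u) ^ Suc k)
        - real (Suc k) * (ln (2 * u) ^ k * dpow (\<lambda>_. 1) (Suc p) u)) (at u)"
    using assms by (intro DERIV_diff DERIV_mult 1 DERIV_cmult Suc.IH one.DERIV_dpow) auto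
  also have "(\<lambda>u. ln (2 * u) ^ Suc k * (u * dpow (\<lambda>_. 1) (Suc p) u)
        - real (Suc k) * log_polylog_prim k (Suc (Suc p)) u) = log_polylog_prim (Suc k) (Suc p)"
    by auto
  also have "(?D * (u * dpow (\<lambda>_. 1) (Suc p) u) + dpow (\<lambda>_. 1) p u * ln (2 * u) ^ Suc k)
        - real (Suc k) * (ln (2 * u) ^ k * dpow (\<lambda>_. 1) (Suc p) u) =
      ln (2 * u) ^ Suc k * dpow (\<lambda>_. 1) p u"
    using assms by (simp del: power_Suc of_nat_Suc)
  finally show ?case .
qed

text \<open>Here ln (2u) = ln 1 = 0, so only the innermost term survives, with the accumulated
  factors -k, -(k-1), ..., -1.\<close>

lemma log_polylog_prim_half:
  "log_polylog_prim k p (1 / 2) = (-1) ^ k * fact k * polylog (p + k) (1 / 2)"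
  by (induction k arbitrary: p) (simp_all add: polylog_eq_dpow)

lemma tendsto_log_polylog_prim: "(log_polylog_prim k p \<longlongrightarrow> 0) (at_right 0)"
proof -
  have *: "((\<lambda>u. ln (2 * u) ^ k * (u * dpow (\<lambda>_. 1) p u)) \<longlongrightarrow> 0) (at_right 0)" for k p
  proof -
    have "((\<lambda>u. ln (2 * u) ^ k * u) \<longlongrightarrow> 0) (at_right (0::real))"
      by real_asymp
    moreover have "(dpow (\<lambda>_. 1) p \<longlongrightarrow> dpow (\<lambda>_. 1) p 0) (at_right 0)"
      using one.isCont_dpow[of 0 p] by (auto simp: isCont_def filterlim_at_split)
    ultimately show ?thesis
      using tendsto_mult by (fastforce simp: mult.assoc)
  qed
  show ?thesis
  proof (induction k arbitrary: p)
    case 0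
    show ?case using *[of 0 p] by simp
  next
    case (Suc k)
    show ?case
      using tendsto_diff[OF *[of "Suc k" p] tendsto_mult_left[OF Suc.IH[of "Suc p"], of "real (Suc k)"]]
      by simp
  qed
qed

section \<open>Comparison of the two antiderivatives\<close>

lemma DERIV_binomial_sum:
  assumes "0 < x" "x < 1" "k \<ge> 1"
  shows "((\<lambda>x. (\<Sum>i=1..k. (-1) ^ i * fact i * ln 2 ^ (k - i) * real (k choose i) *
              (x * dpow (harm_nested (i - 1)) 2 x)) + ln 2 ^ k * ln x)
          has_real_derivative ln (2 * (1 - x)) ^ k / x) (at x)"
proof -
  let ?a = "\<lambda>i. (-1) ^ i * fact i * ln 2 ^ (k - i) * real (k choose i) :: real"
  have "((\<lambda>x. (\<Sum>i=1..k. ?a i * (x * dpow (harm_nested (i - 1)) 2 x)) + ln 2 ^ k * ln x)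
          has_real_derivative
        (\<Sum>i=1..k. ?a i * ((- ln (1 - x)) ^ Suc (i - 1) / fact (Suc (i - 1)) / x)) + ln 2 ^ k * (1 / x))
        (at x)"
    using assms
    by (intro DERIV_add DERIV_sum DERIV_cmult DERIV_dpow_harm_nested_2 DERIV_ln_divide)
  also have "(\<Sum>i=1..k. ?a i * ((- ln (1 - x)) ^ Suc (i - 1) / fact (Suc (i - 1)) / x)) =
      (\<Sum>i=1..k. real (k choose i) * ln (1 - x) ^ i * ln 2 ^ (k - i)) / x"
    unfolding sum_divide_distrib
  proof (intro sum.cong refl)
    fix i assume "i \<in> {1..k}"
    then have "Suc (i - 1) = i" by auto
    moreover have "(-1) ^ i * (- ln (1 - x)) ^ i = ln (1 - x) ^ i"
      by (simp flip: power_mult_distrib)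
    ultimately show "?a i * ((- ln (1 - x)) ^ Suc (i - 1) / fact (Suc (i - 1)) / x) =
        real (k choose i) * ln (1 - x) ^ i * ln 2 ^ (k - i) / x"
      by (simp add: mult_ac)
  qed
  \<comment> \<open>The summand \<open>ln 2 ^ k * ln x\<close> was included for this: its derivative
    is the term i = 0 missing from the binomial expansion of (ln (1 - x) + ln 2)^k.\<close>
  also have "\<dots> + ln 2 ^ k * (1 / x) =
      (\<Sum>i\<le>k. real (k choose i) * ln (1 - x) ^ i * ln 2 ^ (k - i)) / x"
    unfolding atMost_atLeast0 by (subst (2) sum.atLeast_Suc_atMost) (auto simp: add_divide_distrib)
  also have "(\<Sum>i\<le>k. real (k choose i) * ln (1 - x) ^ i * ln 2 ^ (k - i)) = ln (2 * (1 - x)) ^ k"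
    using assms ln_mult_pos[of 2 "1 - x"] by (subst binomial_ring[symmetric]) (simp only: add.commute)
  finally show ?thesis .
qed

theorem mainTheorem8:
  fixes k :: nat
  assumes "k \<ge> 1"
  shows "(\<Sum>i=1..k. (-1) ^ i * fact i * ln 2 ^ (k - i) * real (k choose i) *
            (mzeta (2 # replicate (i - 1) 1) - mzeta_at (2 # replicate (i - 1) 1) (1/2)))
         = (-1) ^ k * fact k * polylog (k + 1) (1/2) - ln 2 ^ (k + 1)"
proof -
  define a :: "nat \<Rightarrow> real"
    where "a = (\<lambda>i. (-1) ^ i * fact i * ln 2 ^ (k - i) * real (k choose i))"
  define A where "A = (\<lambda>x. \<Sum>i=1..k. a i * (x * dpow (harm_nested (i - 1)) 2 x))"
  \<comment> \<open>A sum, not a difference: the substitution u = 1 - x reverses the sign of the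
    second derivative.\<close>
  define F where "F = (\<lambda>x. A x + ln 2 ^ k * ln x + log_polylog_prim k 1 (1 - x))"
  have "(F has_real_derivative 0) (at x)" if x: "0 < x" "x < 1" for x
  proof -
    have "((\<lambda>x. log_polylog_prim k (Suc 0) (1 - x)) has_real_derivative
        ln (2 * (1 - x)) ^ k * dpow (\<lambda>_. 1) 0 (1 - x) * (- 1)) (at x)"
      by (rule DERIV_chain2[OF DERIV_log_polylog_prim])
         (use x in \<open>auto intro!: derivative_eq_intros\<close>)
    moreover have "dpow (\<lambda>_. 1) 0 (1 - x) = 1 / x"
      using x by (simp add: dpow_one_0)
    ultimately show ?thesis
      using DERIV_add[OF DERIV_binomial_sum[OF x assms]] unfolding F_def A_def a_def by fastforce
  qed
  then have F_eq: "F x = F (1 / 2)" if "0 < x" "x < 1" for x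
    using that by (intro DERIV_isconst3[of 0 1 x "1/2" F]) auto
  \<comment> \<open>Constancy is known only on the open interval, so the endpoint 1 is reached as a
    left limit.\<close>
  have "(F \<longlongrightarrow> A 1 + ln 2 ^ k * ln 1 + 0) (at_left 1)"
    unfolding F_def
  proof (intro tendsto_add tendsto_mult tendsto_const)
    have "continuous_on {-1..1} A"
      unfolding A_def by (intro continuous_intros continuous_on_dpow_harm_nested_2)
    then have "(A \<longlongrightarrow> A 1) (at 1 within {-1..1})"
      by (auto simp: continuous_on_def)
    then show "(A \<longlongrightarrow> A 1) (at_left 1)"
      by (simp add: at_within_Icc_at_left)
    show "(ln \<longlongrightarrow> ln 1) (at_left (1::real))"
      by (intro tendsto_ln tendsto_ident_at) auto
    have "filterlim (\<lambda>x::real. 1 - x) (at_right 0) (at_left 1)"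
      by real_asymp
    then show "((\<lambda>x. log_polylog_prim k 1 (1 - x)) \<longlongrightarrow> 0) (at_left 1)"
      by (rule filterlim_compose[OF tendsto_log_polylog_prim])
  qed
  moreover have "(F \<longlongrightarrow> F (1 / 2)) (at_left 1)"
  proof (rule tendsto_eventually)
    have "\<forall>\<^sub>F x in at_left 1. x \<in> {0<..<1::real}"
      by (rule eventually_at_left_real) simp
    then show "\<forall>\<^sub>F x in at_left 1. F x = F (1 / 2)"
      by (rule eventually_mono) (auto intro: F_eq)
  qed
  ultimately have "A 1 + ln 2 ^ k * ln 1 + 0 = F (1 / 2)"
    by (intro tendsto_unique[of "at_left (1::real)"]) auto
  \<comment> \<open>The term -(ln 2)^(k+1) comes from ln (1/2) = -ln 2 in
    \<open>F (1 / 2)\<close>.\<close>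
  then have "A 1 - A (1 / 2) = (-1) ^ k * fact k * polylog (k + 1) (1/2) - ln 2 ^ (k + 1)"
    using log_polylog_prim_half[of k 1] by (simp add: F_def ln_div)
  moreover have "A 1 - A (1 / 2) = (\<Sum>i=1..k. a i *
      (mzeta (2 # replicate (i - 1) 1) - mzeta_at (2 # replicate (i - 1) 1) (1/2)))"
    unfolding A_def sum_subtractf[symmetric]
    by (intro sum.cong refl)
       (simp add: mzeta_eq_mzeta_at mzeta_at_eq_dpow[simplified] right_diff_distrib)
  ultimately show ?thesis by (simp add: a_def)
qed

end
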